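(* Let $S_{m,n}$ be the slant grid graph with $m$ rows and $n$ columns, and let $p,q\in\mathbb N$ (positive integers). (1) If $m=2p$ and $n=8q$, then \[\gamma_{2,1}(S_{m,n})\le (4q+1)p .\] (2) If $m=2p+\ell$ with $\ell\in\{0,1\}$ and $n=8q+k$ with $k\in\{1,2,\dots,7\}$, and at least one of $\ell,k$ is nonzero, then \[\gamma_{2,1}(S_{m,n})\le (4(q+1)+1)(p+1).\]
   Context: The slant grid graph $S_{m,n}$ with $m$ rows and $n$ columns has vertices $(i,j)$ with integers $0\le i\le n-1$ (column, left to right) and $0\le j\le m-1$ (row, bottom to top), and edges joining $(i,j)$ to $(i+1,j)$, to $(i,j+1)$, and to $(i+1,j+1)$ whenever both endpoints are vertices. For a connected graph $G$ with vertex set $V(G)$ and graph distance $d$, positive integers $t,r$, and a set $\mathbb T\subseteq V(G)$ (whose elements are called towers, of strength $t$), the signal received by $v\in V(G)$ is $f(v)=\sum_{w\in\mathbb T}\max\{0,\,t-d(v,w)\}$ (a tower also receives its own signal). The set $\mathbb T$ is a $(t,r)$ broadcast dominating set if $f(v)\ge r$ for every $v\in V(G)$. The $(t,r)$ broadcast domination number $\gamma_{t,r}(G)$ is the minimum cardinality of a $(t,r)$ broadcast dominating set of $G$. *)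

theory Defs
  imports Main
begin

text \<open>
  A graph is given by a vertex set \<open>V\<close> and a symmetric relation \<open>E\<close> on \<open>V\<close>, its adjacency relation.
\<close>

definition connected_graph :: "'a set \<Rightarrow> ('a \<times> 'a) set \<Rightarrow> bool" where
  "connected_graph V E \<longleftrightarrow> (\<forall>v\<in>V. \<forall>w\<in>V. (v, w) \<in> E\<^sup>*)"

text \<open>
  \<open>(v, w) \<in> E ^^ k\<close> says that there is a walk with \<open>k\<close> edges from \<open>v\<close> to \<open>w\<close>.  The distance is
  unspecified when there is no walk at all; it is only used for connected graphs.
\<close>

definition graph_dist :: "('a \<times> 'a) set \<Rightarrow> 'a \<Rightarrow> 'a \<Rightarrow> nat" where
  "graph_dist E v w = (LEAST k. (v, w) \<in> E ^^ k)"

definition signal :: "('a \<times> 'a) set \<Rightarrow> nat \<Rightarrow> 'a set \<Rightarrow> 'a \<Rightarrow> int" where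
  "signal E t T v = (\<Sum>w\<in>T. max 0 (int t - int (graph_dist E v w)))"

definition broadcast_dominating ::
    "'a set \<Rightarrow> ('a \<times> 'a) set \<Rightarrow> nat \<Rightarrow> nat \<Rightarrow> 'a set \<Rightarrow> bool" where
  "broadcast_dominating V E t r T \<longleftrightarrow> T \<subseteq> V \<and> (\<forall>v\<in>V. signal E t T v \<ge> int r)"

text \<open>
  The minimum is unspecified when no dominating set exists; for finite \<open>V\<close> and \<open>r \<le> t\<close> it is
  attained, see \<open>broadcast_domination_number_attained\<close>.
\<close>

definition broadcast_domination_number ::
    "nat \<Rightarrow> nat \<Rightarrow> 'a set \<Rightarrow> ('a \<times> 'a) set \<Rightarrow> nat" where
  "broadcast_domination_number t r V E =
     (LEAST c. \<exists>T. broadcast_dominating V E t r T \<and> card T = c)"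

lemma graph_dist_self [simp]: "graph_dist E v v = 0"
  unfolding graph_dist_def by (rule Least_eq_0) simp

lemma broadcast_domination_number_attained:
  assumes "finite V" and "r \<le> t"
  shows "\<exists>T. broadcast_dominating V E t r T \<and> card T = broadcast_domination_number t r V E"
proof -
  have "int r \<le> signal E t V v" if "v \<in> V" for v
  proof -
    have "int r \<le> max 0 (int t - int (graph_dist E v v))"
      using assms(2) by simp
    also have "\<dots> \<le> signal E t V v"
      unfolding signal_def
      by (rule member_le_sum[where f = "\<lambda>w. max 0 (int t - int (graph_dist E v w))"])
        (use assms(1) that in auto)
    finally show ?thesis .
  qed
  then have "broadcast_dominating V E t r V"
    by (simp add: broadcast_dominating_def)
  then have "\<exists>c T. broadcast_dominating V E t r T \<and> card T = c"
    by blast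
  then show ?thesis
    unfolding broadcast_domination_number_def by (rule LeastI_ex)
qed

text \<open>
  In the slant grid with \<open>m\<close> rows and \<open>n\<close> columns the first coordinate of a vertex is its column
  and the second one its row.
\<close>

definition slant_verts :: "nat \<Rightarrow> nat \<Rightarrow> (nat \<times> nat) set" where
  "slant_verts m n = {(i, j). i < n \<and> j < m}"

definition slant_arcs :: "nat \<Rightarrow> nat \<Rightarrow> ((nat \<times> nat) \<times> (nat \<times> nat)) set" where
  "slant_arcs m n =
     {((i, j), (i', j')). (i, j) \<in> slant_verts m n \<and> (i', j') \<in> slant_verts m n \<and>
        (i', j') \<in> {(i + 1, j), (i, j + 1), (i + 1, j + 1)}}"

definition slant_adj :: "nat \<Rightarrow> nat \<Rightarrow> ((nat \<times> nat) \<times> (nat \<times> nat)) set" where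
  "slant_adj m n = slant_arcs m n \<union> (slant_arcs m n)\<inverse>"

lemma finite_slant_verts: "finite (slant_verts m n)"
proof -
  have "slant_verts m n = {..<n} \<times> {..<m}"
    by (auto simp: slant_verts_def)
  then show ?thesis by simp
qed

lemma connected_slant: "connected_graph (slant_verts m n) (slant_adj m n)"
proof -
  have row: "((0, 0), (0, j)) \<in> (slant_adj m n)\<^sup>*" if "j < m" "0 < n" for j
    using that
  proof (induction j)
    case (Suc j)
    then have "((0, j), (0, Suc j)) \<in> slant_adj m n"
      by (auto simp: slant_adj_def slant_arcs_def slant_verts_def)
    with Suc show ?case by (meson Suc_lessD rtrancl.rtrancl_into_rtrancl)
  qed simp
  have origin: "((0, 0), (i, j)) \<in> (slant_adj m n)\<^sup>*" if "i < n" "j < m" for i j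
    using that
  proof (induction i)
    case 0
    then show ?case using row by simp
  next
    case (Suc i)
    then have "((i, j), (Suc i, j)) \<in> slant_adj m n"
      by (auto simp: slant_adj_def slant_arcs_def slant_verts_def)
    with Suc show ?case by (meson Suc_lessD rtrancl.rtrancl_into_rtrancl)
  qed
  have sym: "sym ((slant_adj m n)\<^sup>*)"
    by (intro sym_rtrancl) (auto simp: slant_adj_def sym_def)
  show ?thesis
    unfolding connected_graph_def
  proof (intro ballI)
    fix v w
    assume "v \<in> slant_verts m n" "w \<in> slant_verts m n"
    then have "((0, 0), v) \<in> (slant_adj m n)\<^sup>*" and w: "((0, 0), w) \<in> (slant_adj m n)\<^sup>*"
      using origin by (cases v, cases w, simp add: slant_verts_def)+
    from symD[OF sym this(1)] w show "(v, w) \<in> (slant_adj m n)\<^sup>*"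
      by (rule rtrancl_trans)
  qed
qed

end

theory Submission
  imports Defs
begin

text \<open>
  The vertex \<open>(i, j)\<close> is adjacent to \<open>(i + 1, j)\<close>, \<open>(i, j + 1)\<close> and \<open>(i + 1, j + 1)\<close>, so it dominates
  the \<open>2 \<times> 2\<close> block of which it is the lower left corner. The blocks with even corners cover the grid,
  which gives the bound \<open>\<lceil>n/2\<rceil> \<lceil>m/2\<rceil>\<close>; it implies both claims.
\<close>

lemma graph_dist_le_1:
  assumes "v = w \<or> (v, w) \<in> E"
  shows "graph_dist E v w \<le> 1"
proof (cases "v = w")
  case False
  with assms have "(v, w) \<in> E ^^ 1" by simp
  then show ?thesis
    unfolding graph_dist_def by (rule Least_le)
qed simp

text \<open>A tower of strength 2 at distance at most 1 contributes at least 1, and the other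
  summands of the signal are nonnegative.\<close>

lemma broadcast_dominating_2_1I:
  assumes "T \<subseteq> V" and "finite T"
    and dom: "\<And>v. v \<in> V \<Longrightarrow> \<exists>w\<in>T. v = w \<or> (v, w) \<in> E"
  shows "broadcast_dominating V E 2 1 T"
  unfolding broadcast_dominating_def
proof (intro conjI ballI)
  fix v assume "v \<in> V"
  then obtain w where w: "w \<in> T" "v = w \<or> (v, w) \<in> E"
    using dom by blast
  have "int 1 \<le> max 0 (int 2 - int (graph_dist E v w))"
    using graph_dist_le_1[OF w(2)] by simp
  also have "\<dots> \<le> signal E 2 T v"
    unfolding signal_def
    by (rule member_le_sum[where f = "\<lambda>w. max 0 (int 2 - int (graph_dist E v w))"])
      (use w(1) assms(2) in auto)
  finally show "int 1 \<le> signal E 2 T v" .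
qed (rule assms(1))

lemma broadcast_domination_number_le_card:
  assumes "broadcast_dominating V E t r T"
  shows "broadcast_domination_number t r V E \<le> card T"
  unfolding broadcast_domination_number_def by (rule Least_le) (use assms in blast)

lemma slant_domination_number_le:
  "broadcast_domination_number 2 1 (slant_verts m n) (slant_adj m n)
     \<le> ((n + 1) div 2) * ((m + 1) div 2)"
proof -
  \<comment> \<open>\<open>(n + 1) div 2\<close> is n/2 rounded up, so \<open>a\<close> ranges
    exactly over the values with \<open>2 * a < n\<close>; likewise for the rows.\<close>
  define I where "I = {..<(n + 1) div 2} \<times> {..<(m + 1) div 2}"
  define T where "T = (\<lambda>(a, b). (2 * a, 2 * b)) ` I"
  have "broadcast_dominating (slant_verts m n) (slant_adj m n) 2 1 T"
  proof (rule broadcast_dominating_2_1I)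
    show "T \<subseteq> slant_verts m n"
      by (auto simp: T_def I_def slant_verts_def)
    show "finite T"
      by (simp add: T_def I_def)
    fix v assume v: "v \<in> slant_verts m n"
    obtain i j where ij: "v = (i, j)" by (cases v)
    \<comment> \<open>The corner of the block containing \<open>v\<close>. Rounding down stays
      inside the grid, even if the block is cut off by the boundary.\<close>
    let ?w = "(2 * (i div 2), 2 * (j div 2))"
    have less: "i < n" "j < m"
      using v ij by (auto simp: slant_verts_def)
    then have "?w \<in> T"
      unfolding T_def I_def by (intro image_eqI[where x = "(i div 2, j div 2)"]) auto
    moreover have "v = ?w \<or> (v, ?w) \<in> slant_adj m n"
    proof -
      \<comment> \<open>The two parities give four cases: \<open>v\<close> is \<open>?w\<close>
        itself or the head of one of the three arcs leaving \<open>?w\<close>, so adjacency comes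
        from the converse arcs.\<close>
      have "i = 2 * (i div 2) \<or> i = 2 * (i div 2) + 1" "j = 2 * (j div 2) \<or> j = 2 * (j div 2) + 1"
        by presburger+
      moreover have "2 * (i div 2) < n" "2 * (j div 2) < m"
        using less by auto
      ultimately show ?thesis
        using less unfolding ij slant_adj_def slant_arcs_def slant_verts_def by auto
    qed
    ultimately show "\<exists>w\<in>T. v = w \<or> (v, w) \<in> slant_adj m n" by blast
  qed
  then have "broadcast_domination_number 2 1 (slant_verts m n) (slant_adj m n) \<le> card T"
    by (rule broadcast_domination_number_le_card)
  also have "card T \<le> card I"
    unfolding T_def by (rule card_image_le) (simp add: I_def)
  also have "card I = ((n + 1) div 2) * ((m + 1) div 2)"
    by (simp add: I_def card_cartesian_product)
  finally show ?thesis .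
qed

theorem theorem5p2:
  fixes m n p q :: nat
  assumes "p \<ge> 1" and "q \<ge> 1"
  shows "(m = 2 * p \<and> n = 8 * q \<longrightarrow>
            broadcast_domination_number 2 1 (slant_verts m n) (slant_adj m n) \<le> (4 * q + 1) * p) \<and>
         (\<forall>(l::nat) (k::nat). l \<in> {0, 1} \<and> k \<in> {1..7} \<and> (l \<noteq> 0 \<or> k \<noteq> 0) \<and> m = 2 * p + l \<and> n = 8 * q + k \<longrightarrow>
            broadcast_domination_number 2 1 (slant_verts m n) (slant_adj m n)
              \<le> (4 * (q + 1) + 1) * (p + 1))"
proof -
  have bound: "broadcast_domination_number 2 1 (slant_verts m n) (slant_adj m n) \<le> a * b"
    if "(n + 1) div 2 \<le> a" "(m + 1) div 2 \<le> b" for a b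
    using slant_domination_number_le mult_le_mono[OF that] by (rule order_trans)
  \<comment> \<open>In the first case the rounded halves are \<open>4 * q\<close> and
    \<open>p\<close>; in the second they are at most \<open>4 * q + 4\<close>, since
    \<open>k \<le> 7\<close>, and \<open>p + 1\<close>.\<close>
  show ?thesis
    by (intro conjI allI impI; rule bound) auto
qed

end
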